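(* Let $N\ge1$, $d\in[0,1)$, let $P$ and $P'$ be nonnegative $N\times N$ matrices each of whose columns sums to one, and let $V\in\mathbb{R}^N$ be a nonnegative vector with entries summing to one. For $k\in\{1,\dots,N\}$ let $J_k$ be the $N\times N$ matrix whose only nonzero entry is $(J_k)_{kk}=1$, and let $I_d$ be the identity matrix. Let $(i_n)_{n\ge1}$ be a sequence in $\{1,\dots,N\}$, and define $$F_0=(1-d)V,\quad F_n=(I_d-J_{i_n}+dPJ_{i_n})F_{n-1},\quad H_n=\sum_{k=1}^nJ_{i_k}F_{k-1}.$$ Fix $n_0\ge0$. Let $(i'_n)_{n\ge1}$ be a sequence in $\{1,\dots,N\}$ in which every value of $\{1,\dots,N\}$ occurs infinitely often, and define $$F'_0=F_{n_0}+d(P'-P)H_{n_0},\quad F'_n=(I_d-J_{i'_n}+dP'J_{i'_n})F'_{n-1},\quad H'_n=\sum_{k=1}^nJ_{i'_k}F'_{k-1}.$$ Let $H'_\infty=\lim_{n\to\infty}H'_n$. Then $X=H_{n_0}+H'_\infty$ is the solution of $$X=dP'X+F_0.$$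
   Context: This describes restarting the fluid-diffusion PageRank computation after the transition matrix is changed from $P$ to $P'$ at iteration $n_0$: the diffusion continues with $P'$ after injecting the extra fluid $d(P'-P)H_{n_0}$. By the algebraic identity for this recursion, $H'_n+F'_n=F'_0+dP'H'_n$ for all $n$. *)

theory Defs
  imports "HOL-Analysis.Analysis"
begin

text \<open>
  In the library's matrices, \<open>A $ a $ b\<close> is the entry in row \<open>a\<close> and column \<open>b\<close>, so the sum below runs down column \<open>b\<close>.
\<close>

definition column_stochastic :: "real ^ 'n ^ 'n \<Rightarrow> bool" where
  "column_stochastic A \<longleftrightarrow>
     (\<forall>a b. 0 \<le> A $ a $ b) \<and> (\<forall>b. (\<Sum>a\<in>UNIV. A $ a $ b) = 1)"

definition probability_vector :: "real ^ 'n \<Rightarrow> bool" where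
  "probability_vector v \<longleftrightarrow> (\<forall>a. 0 \<le> v $ a) \<and> (\<Sum>a\<in>UNIV. v $ a) = 1"

definition J :: "'n::finite \<Rightarrow> real ^ 'n ^ 'n" where
  "J k = (\<chi> a b. if a = k \<and> b = k then 1 else 0)"

text \<open>
  The index sequence \<open>i\<close> is used from index 1 on only; \<open>i 0\<close> plays no role.
\<close>

primrec fluid ::
  "real \<Rightarrow> real ^ 'n ^ 'n \<Rightarrow> (nat \<Rightarrow> 'n::finite) \<Rightarrow> real ^ 'n \<Rightarrow> nat \<Rightarrow> real ^ 'n" where
  "fluid d P i F0 0 = F0"
| "fluid d P i F0 (Suc n) =
     (mat 1 - J (i (Suc n)) + d *\<^sub>R (P ** J (i (Suc n)))) *v fluid d P i F0 n"

definition history ::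
  "real \<Rightarrow> real ^ 'n ^ 'n \<Rightarrow> (nat \<Rightarrow> 'n::finite) \<Rightarrow> real ^ 'n \<Rightarrow> nat \<Rightarrow> real ^ 'n" where
  "history d P i F0 n = (\<Sum>k=1..n. J (i k) *v fluid d P i F0 (k - 1))"

end

theory Submission
  imports Defs
begin

text \<open>
  Diffusing node \<open>k\<close> removes its whole fluid, of absolute value \<open>r\<close>, and hands on at most \<open>d r\<close>, so it
  lowers the l1-norm of the fluid by at least \<open>(1 - d) r\<close>. Hence the diffused amounts are absolutely
  summable, whatever their signs, and the history converges. By the identity \<open>H + F = F\<^sub>0 + d P H\<close>
  the fluid then converges as well, and its limit vanishes at every node because each node is emptied
  infinitely often by amounts tending to 0. The extra fluid \<open>d (P' - P) H\<close> injected at the restart is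
  exactly what turns the identity for \<open>P\<close> into the one for \<open>P'\<close>. The solution is unique because
  \<open>d P'\<close> is a contraction in the l1-norm.
\<close>

lemma tendsto_frequently_eq:
  fixes f :: "'a \<Rightarrow> 'b::t1_space"
  assumes "(f \<longlongrightarrow> l) net" and "\<exists>\<^sub>F x in net. f x = c"
  shows "l = c"
  using tendsto_imp_eventually_ne [OF assms(1)] assms(2) by (auto simp: frequently_def)

lemma frequently_sequentially_Suc_iff_infinite:
  "(\<exists>\<^sub>F n in sequentially. Q (Suc n)) \<longleftrightarrow> infinite {n. 1 \<le> n \<and> Q n}"
proof -
  have "{n. 1 \<le> n \<and> Q n} = Suc ` {n. Q (Suc n)}"
    by (auto simp: image_iff Suc_le_eq gr0_conv_Suc)
  then show ?thesis
    by (simp add: finite_image_iff flip: frequently_cofinite cofinite_eq_sequentially)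
qed

definition l1_norm :: "real ^ 'n \<Rightarrow> real" where
  "l1_norm x = (\<Sum>a\<in>UNIV. \<bar>x $ a\<bar>)"

lemma norm_le_l1_norm: "norm x \<le> l1_norm x"
  unfolding l1_norm_def by (rule norm_le_l1_cart)

lemma l1_norm_nonneg: "0 \<le> l1_norm x"
  by (simp add: l1_norm_def sum_nonneg)

lemma l1_norm_triangle_ineq: "l1_norm (x + y) \<le> l1_norm x + l1_norm y"
  by (simp add: l1_norm_def abs_triangle_ineq sum_mono flip: sum.distrib)

lemma l1_norm_matrix_vector_mult_le:
  assumes "\<And>b. l1_norm (column b A) \<le> c"
  shows "l1_norm (A *v x) \<le> c * l1_norm x"
proof -
  have "l1_norm (A *v x) \<le> (\<Sum>a\<in>UNIV. \<Sum>b\<in>UNIV. \<bar>A $ a $ b\<bar> * \<bar>x $ b\<bar>)"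
    unfolding l1_norm_def matrix_vector_mult_def
    by (auto intro!: sum_mono order_trans [OF sum_abs] simp: abs_mult)
  also have "\<dots> = (\<Sum>b\<in>UNIV. l1_norm (column b A) * \<bar>x $ b\<bar>)"
    by (subst sum.swap) (simp add: l1_norm_def column_def sum_distrib_right)
  also have "\<dots> \<le> (\<Sum>b\<in>UNIV. c * \<bar>x $ b\<bar>)"
    by (intro sum_mono mult_right_mono assms) simp
  finally show ?thesis
    by (simp add: l1_norm_def sum_distrib_left)
qed

lemma J_mult_vector_nth: "(J k *v x) $ a = (if a = k then x $ k else 0)"
  by (simp add: J_def matrix_vector_mult_def if_distrib [of "\<lambda>c. c * _"] cong: if_cong conj_cong)

lemma l1_norm_minus_J: "l1_norm (x - J k *v x) = l1_norm x - l1_norm (J k *v x)"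
  by (auto simp: l1_norm_def J_mult_vector_nth simp flip: sum_subtractf intro!: sum.cong)

locale l1_contraction =
  fixes A :: "real ^ 'n ^ 'n" and c :: real
  assumes l1_norm_column_le: "l1_norm (column b A) \<le> c"
    and less_one: "c < 1"
begin

lemma l1_norm_mult_le: "l1_norm (A *v x) \<le> c * l1_norm x"
  by (rule l1_norm_matrix_vector_mult_le [OF l1_norm_column_le])

lemma affine_fixpoint_unique:
  assumes "x = A *v x + b" and "y = A *v y + b"
  shows "x = y"
proof -
  have "x - y = A *v (x - y)"
    using assms by (metis add_diff_cancel_right matrix_vector_mult_diff_distrib)
  then have "l1_norm (x - y) \<le> c * l1_norm (x - y)"
    using l1_norm_mult_le [of "x - y"] by simp
  then have "(1 - c) * l1_norm (x - y) \<le> 0"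
    by (simp add: algebra_simps)
  then have "l1_norm (x - y) \<le> 0"
    using less_one by (simp add: mult_le_0_iff)
  then have "norm (x - y) \<le> 0"
    by (rule order_trans [OF norm_le_l1_norm])
  then show ?thesis by simp
qed

end

lemma l1_contraction_scaleR_column_stochastic:
  assumes "0 \<le> d" and "d < 1" and "column_stochastic P"
  shows "l1_contraction (d *\<^sub>R P) d"
proof
  show "l1_norm (column b (d *\<^sub>R P)) \<le> d" for b
    using assms
    by (simp add: l1_norm_def column_def column_stochastic_def abs_mult flip: sum_distrib_left)
qed (rule assms(2))

locale diffusion =
  fixes d :: real and P :: "real ^ 'n ^ 'n" and i :: "nat \<Rightarrow> 'n::finite" and F0 :: "real ^ 'n"
begin

abbreviation F :: "nat \<Rightarrow> real ^ 'n" where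
  "F \<equiv> fluid d P i F0"

abbreviation H :: "nat \<Rightarrow> real ^ 'n" where
  "H \<equiv> history d P i F0"

definition diffused :: "nat \<Rightarrow> real ^ 'n" where
  "diffused n = J (i (Suc n)) *v F n"

lemma fluid_Suc: "F (Suc n) = F n - diffused n + (d *\<^sub>R P) *v diffused n"
  by (simp add: diffused_def matrix_vector_mult_add_rdistrib matrix_vector_mult_diff_rdistrib
      flip: scaleR_matrix_vector_assoc matrix_vector_mul_assoc)

lemma history_eq_sum_diffused: "H n = (\<Sum>m<n. diffused m)"
  by (simp add: history_def diffused_def sum.atLeast1_atMost_eq)

lemma history_plus_fluid: "H n + F n = (d *\<^sub>R P) *v H n + F0"
proof (induction n)
  case 0
  show ?case by (simp add: history_eq_sum_diffused)
next
  case (Suc n)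
  then show ?case
    by (simp add: history_eq_sum_diffused fluid_Suc matrix_vector_right_distrib add_ac
        del: fluid.simps(2))
qed

end

locale contracting_diffusion =
  diffusion d P i F0 + l1_contraction "d *\<^sub>R P" c
  for d :: real and P :: "real ^ 'n ^ 'n" and i :: "nat \<Rightarrow> 'n::finite" and F0 :: "real ^ 'n"
    and c :: real
begin

lemma l1_norm_fluid_Suc_le:
  "l1_norm (F (Suc n)) + (1 - c) * l1_norm (diffused n) \<le> l1_norm (F n)"
proof -
  have "l1_norm (F (Suc n)) \<le> l1_norm (F n - diffused n) + l1_norm ((d *\<^sub>R P) *v diffused n)"
    unfolding fluid_Suc by (rule l1_norm_triangle_ineq)
  also have "l1_norm (F n - diffused n) = l1_norm (F n) - l1_norm (diffused n)"
    unfolding diffused_def by (rule l1_norm_minus_J)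
  also have "l1_norm ((d *\<^sub>R P) *v diffused n) \<le> c * l1_norm (diffused n)"
    by (rule l1_norm_mult_le)
  finally show ?thesis
    by (simp add: algebra_simps)
qed

lemma sum_l1_norm_diffused_le: "(1 - c) * (\<Sum>m<n. l1_norm (diffused m)) \<le> l1_norm F0"
proof -
  have "l1_norm (F n) + (1 - c) * (\<Sum>m<n. l1_norm (diffused m)) \<le> l1_norm F0"
  proof (induction n)
    case (Suc n)
    then show ?case
      using l1_norm_fluid_Suc_le [of n] by (simp add: distrib_left del: fluid.simps(2))
  qed simp
  then show ?thesis
    using l1_norm_nonneg [of "F n"] by linarith
qed

lemma summable_diffused: "summable diffused"
proof (rule summable_comparison_test')
  show "summable (\<lambda>n. l1_norm (diffused n))"
  proof (rule summableI_nonneg_bounded)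
    show "(\<Sum>m<n. l1_norm (diffused m)) \<le> l1_norm F0 / (1 - c)" for n
      using sum_l1_norm_diffused_le [of n] less_one by (simp add: pos_le_divide_eq mult.commute)
  qed (rule l1_norm_nonneg)
qed (rule norm_le_l1_norm)

lemma convergent_history: "convergent H"
  using summable_diffused
  by (simp add: history_eq_sum_diffused [abs_def] summable_iff_convergent)

lemma fluid_tendsto_0:
  assumes "\<And>k. \<exists>\<^sub>F n in sequentially. i (Suc n) = k"
  shows "F \<longlonglongrightarrow> 0"
proof -
  obtain L where "H \<longlonglongrightarrow> L"
    using convergent_history by (auto simp: convergent_def)
  then have "(\<lambda>n. (d *\<^sub>R P) *v H n + F0 - H n) \<longlonglongrightarrow> (d *\<^sub>R P) *v L + F0 - L"
    by (intro tendsto_intros bounded_linear.tendsto [OF matrix_vector_mul_bounded_linear])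
  then obtain G where fluid_tendsto: "F \<longlonglongrightarrow> G"
    by (simp flip: history_plus_fluid)
  have "G $ k = 0" for k
  proof (rule tendsto_frequently_eq)
    have "(\<lambda>n. F n - diffused n) \<longlonglongrightarrow> G - 0"
      by (intro tendsto_diff fluid_tendsto summable_LIMSEQ_zero summable_diffused)
    from tendsto_vec_nth [OF this]
    show "(\<lambda>n. (F n - diffused n) $ k) \<longlonglongrightarrow> G $ k" by simp
    show "\<exists>\<^sub>F n in sequentially. (F n - diffused n) $ k = 0"
      using assms [of k] by (rule frequently_elim1) (simp add: diffused_def J_mult_vector_nth)
  qed
  then have "G = 0"
    by (simp add: vec_eq_iff)
  with fluid_tendsto show ?thesis by simp
qed

lemma lim_history_fixpoint:
  assumes "\<And>k. \<exists>\<^sub>F n in sequentially. i (Suc n) = k"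
  shows "lim H = (d *\<^sub>R P) *v lim H + F0"
proof (rule LIMSEQ_unique)
  have history_tendsto: "H \<longlonglongrightarrow> lim H"
    using convergent_history by (simp add: convergent_LIMSEQ_iff)
  have "(\<lambda>n. H n + F n) \<longlonglongrightarrow> lim H + 0"
    by (intro tendsto_add history_tendsto fluid_tendsto_0 assms)
  then show "(\<lambda>n. H n + F n) \<longlonglongrightarrow> lim H" by simp
  show "(\<lambda>n. H n + F n) \<longlonglongrightarrow> (d *\<^sub>R P) *v lim H + F0"
    unfolding history_plus_fluid
    by (intro tendsto_intros history_tendsto
        bounded_linear.tendsto [OF matrix_vector_mul_bounded_linear])
qed

end

theorem theorem4:
  fixes d :: real
    and P P' :: "real ^ 'n ^ 'n"
    and V F\<^sub>0 F'\<^sub>0 X :: "real ^ 'n"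
    and i i' :: "nat \<Rightarrow> 'n::finite"
    and n\<^sub>0 :: nat
    and F H H' :: "nat \<Rightarrow> real ^ 'n"
  assumes "0 \<le> d" and "d < 1"
    and "column_stochastic P" and "column_stochastic P'"
    and "probability_vector V"
    and "\<forall>k. infinite {n. 1 \<le> n \<and> i' n = k}"
  defines "F\<^sub>0 \<equiv> (1 - d) *\<^sub>R V"
    and "F \<equiv> fluid d P i F\<^sub>0"
    and "H \<equiv> history d P i F\<^sub>0"
    and "F'\<^sub>0 \<equiv> F n\<^sub>0 + (d *\<^sub>R (P' - P)) *v H n\<^sub>0"
    and "H' \<equiv> history d P' i' F'\<^sub>0"
    and "X \<equiv> H n\<^sub>0 + lim H'"
  shows "convergent H' \<and>
         X = (d *\<^sub>R P') *v X + F\<^sub>0 \<and>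
         (\<forall>Y. Y = (d *\<^sub>R P') *v Y + F\<^sub>0 \<longrightarrow> Y = X)"
proof -
  interpret restart: contracting_diffusion d P' i' F'\<^sub>0 d
    by (intro contracting_diffusion.intro l1_contraction_scaleR_column_stochastic assms(1,2,4))
  have "\<exists>\<^sub>F n in sequentially. i' (Suc n) = k" for k
    using assms(6) frequently_sequentially_Suc_iff_infinite [of "\<lambda>n. i' n = k"] by blast
  then have restart_fixpoint: "lim H' = (d *\<^sub>R P') *v lim H' + F'\<^sub>0"
    unfolding H'_def by (rule restart.lim_history_fixpoint)
  have "H n\<^sub>0 + F n\<^sub>0 = (d *\<^sub>R P) *v H n\<^sub>0 + F\<^sub>0"
    unfolding H_def F_def by (rule diffusion.history_plus_fluid)
  then have restart_balance: "H n\<^sub>0 + F'\<^sub>0 = (d *\<^sub>R P') *v H n\<^sub>0 + F\<^sub>0"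
    by (simp add: F'\<^sub>0_def scaleR_diff_right matrix_vector_mult_diff_rdistrib algebra_simps)
  have "X = (H n\<^sub>0 + F'\<^sub>0) + (d *\<^sub>R P') *v lim H'"
    unfolding X_def by (subst restart_fixpoint) (simp add: add_ac)
  also have "\<dots> = (d *\<^sub>R P') *v X + F\<^sub>0"
    unfolding restart_balance by (simp add: X_def matrix_vector_right_distrib add_ac)
  finally have "X = (d *\<^sub>R P') *v X + F\<^sub>0" .
  then show ?thesis
    using restart.convergent_history restart.affine_fixpoint_unique unfolding H'_def by blast
qed

end
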